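(* Let $X_1$ and $X_2$ be independent random variables, each distributed as $\mathcal{C}(0,1)$, and let $w_1,w_2>0$. Then $Z=w_1X_1+w_2X_2\sim\mathcal{C}(0,w_1+w_2)$.
   Context: $\mathcal{C}(0,w)$, for $w>0$, denotes the Cauchy distribution with location $0$ and scale $w$, i.e. with density $z\mapsto\frac{1}{\pi w}\,\frac{1}{1+z^2/w^2}$ on $\mathbb{R}$. *)

theory Defs
  imports "HOL-Probability.Probability"
begin

definition cauchy_density :: "real \<Rightarrow> real \<Rightarrow> real \<Rightarrow> real" where
  "cauchy_density m w z = 1 / (pi * w) * (1 / (1 + (z - m)\<^sup>2 / w\<^sup>2))"

end

theory Submission
  imports Defs "HOL-Real_Asymp.Real_Asymp"
begin

text \<open>
  The density of the sum is the convolution of the densities of the scaled variables. The convolution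
  integrand \<open>1 / ((b\<^sup>2 + y\<^sup>2) (a\<^sup>2 + (y - z)\<^sup>2))\<close> splits into partial fractions with common denominator
  \<open>D = (z\<^sup>2 + (a - b)\<^sup>2) (z\<^sup>2 + (a + b)\<^sup>2)\<close>, so it has an elementary antiderivative. Its logarithmic part
  vanishes at both ends, and its arctangents give the result. The splitting breaks down for \<open>z = 0\<close>
  and \<open>a = b\<close>, but a density matters only almost everywhere, so \<open>z = 0\<close> may be left out.
\<close>

text \<open>For a nonnegative integrand, finite limits of the antiderivative at both ends already
  give integrability. This lets the fundamental theorem for \<open>einterval\<close> pass to the
  whole line and then to the nonnegative integral.\<close>

lemma nn_integral_FTC_real:
  fixes f F :: "real \<Rightarrow> real"
  assumes "\<And>x. (F has_real_derivative f x) (at x)"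
    and "continuous_on UNIV f"
    and "\<And>x. 0 \<le> f x"
    and "(F \<longlongrightarrow> A) at_bot" and "(F \<longlongrightarrow> B) at_top"
  shows "(\<integral>\<^sup>+x. ennreal (f x) \<partial>lborel) = ennreal (B - A)"
proof -
  have cont: "isCont f x" for x
    using assms(2) by (simp add: continuous_on_eq_continuous_at)
  have A: "((F \<circ> real_of_ereal) \<longlongrightarrow> A) (at_right (-\<infinity>))"
    and B: "((F \<circ> real_of_ereal) \<longlongrightarrow> B) (at_left \<infinity>)"
    using assms(4,5) by (simp_all add: ereal_tendsto_simps)
  have "set_integrable lborel (einterval (-\<infinity>) \<infinity>) f"
    by (rule interval_integral_FTC_nonneg(1)[OF _ _ _ _ A B]) (use assms cont in auto)
  then have int: "integrable lborel f"
    by (simp add: set_integrable_def einterval_eq)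
  have "(LBINT x=-\<infinity>..\<infinity>. f x) = B - A"
    by (rule interval_integral_FTC_nonneg(2)[OF _ _ _ _ A B]) (use assms cont in auto)
  then have "(LINT x|lborel. f x) = B - A"
    by (simp add: interval_lebesgue_integral_def set_lebesgue_integral_def einterval_eq)
  then show ?thesis
    using nn_integral_eq_integral[OF int] assms(3) by simp
qed

text \<open>A polynomial denominator turns products of densities into rational functions fit for
  partial fractions.\<close>

lemma cauchy_density_zero_location:
  assumes "w \<noteq> 0"
  shows "cauchy_density 0 w z = w / (pi * (w\<^sup>2 + z\<^sup>2))"
proof -
  have "w\<^sup>2 + z\<^sup>2 \<noteq> 0"
    using assms by (simp add: sum_power2_eq_zero_iff)
  then show ?thesis
    using assms unfolding cauchy_density_def
    by (simp add: divide_simps) (simp add: power2_eq_square algebra_simps)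
qed

lemma cauchy_density_nonneg: "w \<ge> 0 \<Longrightarrow> 0 \<le> cauchy_density m w z"
  by (simp add: cauchy_density_def)

lemma borel_measurable_cauchy_density [measurable]: "cauchy_density m w \<in> borel_measurable borel"
  unfolding cauchy_density_def by measurable

lemma cauchy_antiderivative:
  fixes a b z y :: real
  assumes "a > 0" "b > 0"
  shows "((\<lambda>y. z * (ln (b\<^sup>2 + y\<^sup>2) - ln (a\<^sup>2 + (y - z)\<^sup>2))
            + (z\<^sup>2 + a\<^sup>2 - b\<^sup>2) / b * arctan (y / b)
            + (z\<^sup>2 + b\<^sup>2 - a\<^sup>2) / a * arctan ((y - z) / a))
          has_real_derivative
          ((z\<^sup>2 + (a - b)\<^sup>2) * (z\<^sup>2 + (a + b)\<^sup>2)) / ((b\<^sup>2 + y\<^sup>2) * (a\<^sup>2 + (y - z)\<^sup>2))) (at y)"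
proof -
  have pos: "b\<^sup>2 + y\<^sup>2 > 0" "a\<^sup>2 + (y - z)\<^sup>2 > 0"
    using assms by (simp_all add: add_pos_nonneg)
  have arctan: "((\<lambda>y. k / c * arctan ((y - d) / c)) has_real_derivative k / (c\<^sup>2 + (y - d)\<^sup>2)) (at y)"
    if "c > 0" for k c d :: real
  proof -
    have "c\<^sup>2 + (y - d)\<^sup>2 > 0"
      using that by (simp add: add_pos_nonneg)
    then have "k / c * (inverse (1 + ((y - d) / c)\<^sup>2) * (1 / c)) = k / (c\<^sup>2 + (y - d)\<^sup>2)"
      using that by (simp add: divide_simps power2_eq_square)
    then show ?thesis
      using that by (auto intro!: derivative_eq_intros simp: mult.commute)
  qed
  have "((\<lambda>y. z * (ln (b\<^sup>2 + y\<^sup>2) - ln (a\<^sup>2 + (y - z)\<^sup>2))) has_real_derivative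
          z * (2 * y / (b\<^sup>2 + y\<^sup>2) - 2 * (y - z) / (a\<^sup>2 + (y - z)\<^sup>2))) (at y)"
    using pos by (auto intro!: derivative_eq_intros)
  from DERIV_add[OF DERIV_add[OF this arctan[OF assms(2), of "z\<^sup>2 + a\<^sup>2 - b\<^sup>2" 0]]
      arctan[OF assms(1), of "z\<^sup>2 + b\<^sup>2 - a\<^sup>2" z]]
  have deriv: "((\<lambda>y. z * (ln (b\<^sup>2 + y\<^sup>2) - ln (a\<^sup>2 + (y - z)\<^sup>2))
            + (z\<^sup>2 + a\<^sup>2 - b\<^sup>2) / b * arctan (y / b)
            + (z\<^sup>2 + b\<^sup>2 - a\<^sup>2) / a * arctan ((y - z) / a))
          has_real_derivative
          z * (2 * y / (b\<^sup>2 + y\<^sup>2) - 2 * (y - z) / (a\<^sup>2 + (y - z)\<^sup>2))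
            + (z\<^sup>2 + a\<^sup>2 - b\<^sup>2) / (b\<^sup>2 + y\<^sup>2) + (z\<^sup>2 + b\<^sup>2 - a\<^sup>2) / (a\<^sup>2 + (y - z)\<^sup>2)) (at y)"
    by simp
  \<comment> \<open>Keeping \<open>P\<close> and \<open>Q\<close> atomic clears the denominators
    without expanding the quadratics.\<close>
  have common_denominator: "z * (2 * y / P - 2 * (y - z) / Q) + r / P + s / Q
      = ((2 * z * y + r) * Q + (s - 2 * z * (y - z)) * P) / (P * Q)"
    if "P > 0" "Q > 0" for P Q r s :: real
    using that by (simp add: field_simps)
  \<comment> \<open>The partial fraction coefficients are chosen so that every power of
    \<open>y\<close> cancels from the numerator.\<close>
  have "(2 * z * y + (z\<^sup>2 + a\<^sup>2 - b\<^sup>2)) * (a\<^sup>2 + (y - z)\<^sup>2)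
      + ((z\<^sup>2 + b\<^sup>2 - a\<^sup>2) - 2 * z * (y - z)) * (b\<^sup>2 + y\<^sup>2)
      = (z\<^sup>2 + (a - b)\<^sup>2) * (z\<^sup>2 + (a + b)\<^sup>2)"
    by (simp add: power2_eq_square algebra_simps)
  with deriv show ?thesis
    unfolding common_denominator[OF pos] by simp
qed

lemma nn_integral_cauchy_density_convolution:
  assumes "a > 0" "b > 0" "z \<noteq> 0"
  shows "(\<integral>\<^sup>+y. ennreal (cauchy_density 0 a (z - y)) * ennreal (cauchy_density 0 b y) \<partial>lborel)
       = ennreal (cauchy_density 0 (a + b) z)"
proof -
  define D where "D = (z\<^sup>2 + (a - b)\<^sup>2) * (z\<^sup>2 + (a + b)\<^sup>2)"
  \<comment> \<open>The densities contribute \<open>a * b / pi\<^sup>2\<close>; dividing by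
    \<open>D\<close> offsets the \<open>D\<close> in the derivative of \<open>G\<close>.\<close>
  define c where "c = a * b / (pi\<^sup>2 * D)"
  define G where "G y = z * (ln (b\<^sup>2 + y\<^sup>2) - ln (a\<^sup>2 + (y - z)\<^sup>2))
            + (z\<^sup>2 + a\<^sup>2 - b\<^sup>2) / b * arctan (y / b)
            + (z\<^sup>2 + b\<^sup>2 - a\<^sup>2) / a * arctan ((y - z) / a)" for y
  \<comment> \<open>Both arctangents have the same limit at each end, so only the sum
    \<open>K\<close> of their coefficients matters.\<close>
  define K where "K = (z\<^sup>2 + a\<^sup>2 - b\<^sup>2) / b + (z\<^sup>2 + b\<^sup>2 - a\<^sup>2) / a"
  define f where "f y = cauchy_density 0 a (z - y) * cauchy_density 0 b y" for y
  have D_pos: "D > 0"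
    unfolding D_def using assms by (simp add: add_pos_nonneg)
  have f_eq: "f y = c * (D / ((b\<^sup>2 + y\<^sup>2) * (a\<^sup>2 + (y - z)\<^sup>2)))" for y
    using assms D_pos
    by (simp add: f_def c_def cauchy_density_zero_location power2_commute[of z] power2_eq_square[of pi])
  have lim: "((\<lambda>y. c * G y) \<longlongrightarrow> c * (K * t)) F"
    if "((\<lambda>y. ln (b\<^sup>2 + y\<^sup>2) - ln (a\<^sup>2 + (y - z)\<^sup>2)) \<longlongrightarrow> 0) F"
      and "((\<lambda>y. arctan (y / b)) \<longlongrightarrow> t) F"
      and "((\<lambda>y. arctan ((y - z) / a)) \<longlongrightarrow> t) F" for t F
  proof -
    have "((\<lambda>y. c * G y) \<longlongrightarrow> c * (z * 0 + (z\<^sup>2 + a\<^sup>2 - b\<^sup>2) / b * t + (z\<^sup>2 + b\<^sup>2 - a\<^sup>2) / a * t)) F"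
      unfolding G_def by (intro tendsto_add tendsto_mult_left that)
    then show ?thesis
      by (simp add: K_def distrib_right)
  qed
  have "((\<lambda>y. c * G y) has_real_derivative f y) (at y)" for y
    unfolding f_eq G_def D_def using assms by (intro DERIV_cmult cauchy_antiderivative)
  moreover have "continuous_on UNIV f"
    unfolding f_def cauchy_density_def using assms
    by (intro continuous_intros) (auto simp: add_nonneg_eq_0_iff)
  moreover have "0 \<le> f y" for y
    using assms by (simp add: f_def cauchy_density_nonneg)
  \<comment> \<open>Both quadratics have leading term \<open>y\<^sup>2\<close>, so the difference of
    their logarithms tends to 0.\<close>
  moreover have "((\<lambda>y. c * G y) \<longlongrightarrow> c * (K * (- pi / 2))) at_bot"
    by (rule lim) (use assms in real_asymp)+
  moreover have "((\<lambda>y. c * G y) \<longlongrightarrow> c * (K * (pi / 2))) at_top"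
    by (rule lim) (use assms in real_asymp)+
  ultimately have "(\<integral>\<^sup>+y. ennreal (f y) \<partial>lborel) = ennreal (c * (K * (pi / 2)) - c * (K * (- pi / 2)))"
    by (rule nn_integral_FTC_real)
  also have "c * (K * (pi / 2)) - c * (K * (- pi / 2)) = c * K * pi"
    by simp
  also have "c * K * pi = cauchy_density 0 (a + b) z"
  proof -
    \<comment> \<open>The factor \<open>z\<^sup>2 + (a - b)\<^sup>2\<close> cancels against the same
      factor of \<open>D\<close>, leaving only the denominator of scale
      \<open>a + b\<close>.\<close>
    have "K = (a + b) * (z\<^sup>2 + (a - b)\<^sup>2) / (a * b)"
    proof -
      have "a * (z\<^sup>2 + a\<^sup>2 - b\<^sup>2) + b * (z\<^sup>2 + b\<^sup>2 - a\<^sup>2) = (a + b) * (z\<^sup>2 + (a - b)\<^sup>2)"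
        by (simp add: power2_eq_square algebra_simps)
      moreover have "r / b + s / a = (a * r + b * s) / (a * b)" for r s
        using assms by (simp add: field_simps)
      ultimately show ?thesis
        by (simp add: K_def)
    qed
    moreover have "z\<^sup>2 + (a - b)\<^sup>2 > 0"
      using assms by (simp add: add_pos_nonneg)
    ultimately show ?thesis
      using assms by (simp add: c_def D_def cauchy_density_zero_location power2_eq_square[of pi] add.commute[of "z\<^sup>2"])
  qed
  finally show ?thesis
    using assms by (simp add: f_def ennreal_mult cauchy_density_nonneg)
qed

lemma (in prob_space) distributed_cauchy_scale:
  assumes X: "distributed M lborel X (\<lambda>z. ennreal (cauchy_density 0 1 z))" and "w > 0"
  shows "distributed M lborel (\<lambda>\<omega>. w * X \<omega>) (\<lambda>z. ennreal (cauchy_density 0 w z))"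
proof -
  \<comment> \<open>The Jacobian \<open>w\<close> of the substitution \<open>z = x * w\<close>
    cancels the \<open>1 / w\<close> in the normalising constant.\<close>
  have "w * cauchy_density 0 w (x * w) = cauchy_density 0 1 x" for x
    using \<open>w > 0\<close> by (simp add: cauchy_density_def power_mult_distrib)
  then have density: "ennreal w * ennreal (cauchy_density 0 w (x * w)) = ennreal (cauchy_density 0 1 x)" for x
    using \<open>w > 0\<close> by (simp flip: ennreal_mult')
  show ?thesis
    by (rule distributed_affineI[where t = 0 and c = w]) (use X \<open>w > 0\<close> density in simp_all)
qed

theorem lemma4:
  fixes M :: "'a measure" and X1 X2 :: "'a \<Rightarrow> real" and w1 w2 :: real
  assumes "prob_space M"
    and "prob_space.indep_var M borel X1 borel X2"
    and "distributed M lborel X1 (\<lambda>z. ennreal (cauchy_density 0 1 z))"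
    and "distributed M lborel X2 (\<lambda>z. ennreal (cauchy_density 0 1 z))"
    and "w1 > 0" and "w2 > 0"
  shows "distributed M lborel (\<lambda>\<omega>. w1 * X1 \<omega> + w2 * X2 \<omega>)
           (\<lambda>z. ennreal (cauchy_density 0 (w1 + w2) z))"
proof -
  interpret prob_space M by fact
  let ?h = "\<lambda>z. \<integral>\<^sup>+y. ennreal (cauchy_density 0 w1 (z - y)) * ennreal (cauchy_density 0 w2 y) \<partial>lborel"
  have "indep_var borel ((*) w1 \<circ> X1) borel ((*) w2 \<circ> X2)"
    using assms(2) by (rule indep_var_compose) auto
  then have "distributed M lborel (\<lambda>\<omega>. w1 * X1 \<omega> + w2 * X2 \<omega>) ?h"
    using assms by (intro distributed_convolution distributed_cauchy_scale) (simp_all add: comp_def)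
  \<comment> \<open>The convolution was evaluated only for \<open>z \<noteq> 0\<close>, which
    suffices because \<open>{0}\<close> is a null set.\<close>
  moreover have "AE z in lborel. ?h z = ennreal (cauchy_density 0 (w1 + w2) z)"
    using AE_lborel_singleton[of 0]
    by eventually_elim (use assms nn_integral_cauchy_density_convolution in blast)
  ultimately show ?thesis
    by (subst (asm) distributed_cong_density) (auto intro: distributed_borel_measurable)
qed

end
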